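(* Let $X_1,\dots,X_n$ be i.i.d. $N_p(\theta,\Sigma)$ with $\Sigma$ an unknown arbitrary positive definite matrix. Let $\mathcal{H}_p^*=\{\theta\in\mathbb{R}^p:\theta_p\ge0\}$ and let $\mathcal{C}$ be a closed convex cone such that $\mathcal{U}\subseteq\mathcal{C}\subseteq\mathcal{H}_p^*$ for some nonempty $p$-dimensional open set $\mathcal{U}$ contained in $\mathcal{H}_p^*$. Then the union-intersection test (UIT) for testing $H_0:\theta=0$ against $H_1:\theta\in\mathcal{C}\setminus\{0\}$ is dominated by the UIT for testing $H_0:\theta=0$ against $H_1:\theta\in\mathcal{H}_p^*\setminus\{0\}$.
   Context: Setting: $n>p$; $\mathcal{M}$ is the set of $p\times p$ positive definite matrices and $\Sigma$ ranges over $\mathcal{M}$. Put $\bar X_n=n^{-1}\sum_i X_i$ and $S_n=(n-1)^{-1}\sum_i(X_i-\bar X_n)(X_i-\bar X_n)'$. For a positive definite matrix $A$, let $\langle x,y\rangle_A=x'A^{-1}y$ with norm $\|\cdot\|_A$, and let $\pi_A(x;\mathcal{C})$ be the orthogonal projection of $x$ onto the closed convex cone $\mathcal{C}$ with respect to $\langle\cdot,\cdot\rangle_A$. The UIT against $\mathcal{C}\setminus\{0\}$ uses the statistic $\|\pi_{S_n}(n^{1/2}\bar X_n;\mathcal{C})\|_{S_n}^2$ and rejects $H_0$ when it is $\ge c$, where $c>0$ is determined by the level of significance $\alpha$ through the requirement that the supremum over $\Sigma\in\mathcal{M}$ of the rejection probability at $\theta=0$ equals $\alpha$; similarly with $\mathcal{H}_p^*$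 in place of $\mathcal{C}$. "Dominated" means: for the same $\alpha$, at every $(\theta,\Sigma)$ with $\theta\in\mathcal{C}\setminus\{0\}$ and $\Sigma\in\mathcal{M}$, the power (rejection probability) of the dominating test is at least that of the dominated test. *)

theory Defs
  imports "HOL-Probability.Probability"
begin

text \<open>
  Vectors of dimension p are modelled as \<^typ>\<open>real ^ 'p\<close>. The index type is linearly ordered, so
  that ``the last coordinate'' is the one with index \<^term>\<open>Max UNIV\<close>.
\<close>

definition upper_halfspace :: "(real ^ 'p :: {finite, linorder}) set" where
  "upper_halfspace = {\<theta>. 0 \<le> \<theta> $ Max UNIV}"

definition pos_def :: "(real ^ 'p ^ 'p :: finite) set" where
  "pos_def = {A. transpose A = A \<and> (\<forall>x. x \<noteq> 0 \<longrightarrow> 0 < x \<bullet> (A *v x))}"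

definition inner_wrt :: "real ^ 'p ^ 'p \<Rightarrow> real ^ 'p \<Rightarrow> real ^ 'p :: finite \<Rightarrow> real" where
  "inner_wrt A x y = x \<bullet> (matrix_inv A *v y)"

definition norm_wrt :: "real ^ 'p ^ 'p \<Rightarrow> real ^ 'p :: finite \<Rightarrow> real" where
  "norm_wrt A x = sqrt (inner_wrt A x x)"

definition proj_wrt :: "real ^ 'p ^ 'p \<Rightarrow> (real ^ 'p :: finite) set \<Rightarrow> real ^ 'p \<Rightarrow> real ^ 'p" where
  "proj_wrt A C x = arg_min_on (\<lambda>y. norm_wrt A (x - y)) C"

definition mvnormal_density :: "real ^ 'p \<Rightarrow> real ^ 'p ^ 'p \<Rightarrow> real ^ 'p :: finite \<Rightarrow> real" where
  "mvnormal_density \<theta> \<Sigma> x =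
     exp (- inner_wrt \<Sigma> (x - \<theta>) (x - \<theta>) / 2) / sqrt ((2 * pi) ^ CARD('p) * det \<Sigma>)"

definition iid_normal ::
    "nat \<Rightarrow> 'a measure \<Rightarrow> (nat \<Rightarrow> 'a \<Rightarrow> real ^ 'p :: finite) \<Rightarrow> real ^ 'p \<Rightarrow> real ^ 'p ^ 'p \<Rightarrow> bool" where
  "iid_normal n M X \<theta> \<Sigma> \<longleftrightarrow>
     prob_space M \<and>
     prob_space.indep_vars M (\<lambda>_. borel) X {1..n} \<and>
     (\<forall>i\<in>{1..n}. distributed M lborel (X i) (\<lambda>x. ennreal (mvnormal_density \<theta> \<Sigma> x)))"

definition sample_mean :: "nat \<Rightarrow> (nat \<Rightarrow> real ^ 'p :: finite) \<Rightarrow> real ^ 'p" where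
  "sample_mean n x = (1 / real n) *\<^sub>R (\<Sum>i=1..n. x i)"

definition outer_square :: "real ^ 'p :: finite \<Rightarrow> real ^ 'p ^ 'p" where
  "outer_square v = (\<chi> i j. v $ i * v $ j)"

definition sample_cov :: "nat \<Rightarrow> (nat \<Rightarrow> real ^ 'p :: finite) \<Rightarrow> real ^ 'p ^ 'p" where
  "sample_cov n x =
     (1 / (real n - 1)) *\<^sub>R (\<Sum>i=1..n. outer_square (x i - sample_mean n x))"

text \<open>
  The sample covariance matrix is positive definite only almost surely (for n > p). On the
  exceptional null set the statistic is set to 0 instead of a junk value: otherwise the rejection
  event might fail to be measurable, and \<^const>\<open>measure\<close> returns 0 on non-measurable sets.
\<close>

definition uit_statistic ::
    "nat \<Rightarrow> (real ^ 'p :: finite) set \<Rightarrow> (nat \<Rightarrow> real ^ 'p) \<Rightarrow> real" where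
  "uit_statistic n C x =
     (let S = sample_cov n x in
      if S \<in> pos_def then (norm_wrt S (proj_wrt S C (sqrt (real n) *\<^sub>R sample_mean n x)))\<^sup>2 else 0)"

text \<open>A (nonrandomized) test is the predicate on samples that says when the null is rejected.\<close>

definition uit :: "nat \<Rightarrow> (real ^ 'p :: finite) set \<Rightarrow> real \<Rightarrow> (nat \<Rightarrow> real ^ 'p) \<Rightarrow> bool" where
  "uit n C c x \<longleftrightarrow> c \<le> uit_statistic n C x"

text \<open>
  A statistical model is a family of probability spaces \<open>M \<theta> \<Sigma>\<close>, together with random vectors
  \<open>X 1, \<dots>, X n\<close> that do not depend on the parameters.
\<close>

definition power_fn ::
    "(real ^ 'p \<Rightarrow> real ^ 'p ^ 'p \<Rightarrow> 'a measure) \<Rightarrow> (nat \<Rightarrow> 'a \<Rightarrow> real ^ 'p :: finite) \<Rightarrow>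
     ((nat \<Rightarrow> real ^ 'p) \<Rightarrow> bool) \<Rightarrow> real ^ 'p \<Rightarrow> real ^ 'p ^ 'p \<Rightarrow> real" where
  "power_fn M X \<phi> \<theta> \<Sigma> = measure (M \<theta> \<Sigma>) {\<omega> \<in> space (M \<theta> \<Sigma>). \<phi> (\<lambda>i. X i \<omega>)}"

definition critical_value ::
    "(real ^ 'p \<Rightarrow> real ^ 'p ^ 'p \<Rightarrow> 'a measure) \<Rightarrow> (nat \<Rightarrow> 'a \<Rightarrow> real ^ 'p :: finite) \<Rightarrow>
     nat \<Rightarrow> (real ^ 'p) set \<Rightarrow> real \<Rightarrow> real \<Rightarrow> bool" where
  "critical_value M X n C \<alpha> c \<longleftrightarrow>
     0 < c \<and> (SUP \<Sigma>\<in>pos_def. power_fn M X (uit n C c) 0 \<Sigma>) = \<alpha>"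

definition dominated_by ::
    "(real ^ 'p \<Rightarrow> real ^ 'p ^ 'p \<Rightarrow> 'a measure) \<Rightarrow> (nat \<Rightarrow> 'a \<Rightarrow> real ^ 'p :: finite) \<Rightarrow>
     (real ^ 'p) set \<Rightarrow> ((nat \<Rightarrow> real ^ 'p) \<Rightarrow> bool) \<Rightarrow> ((nat \<Rightarrow> real ^ 'p) \<Rightarrow> bool) \<Rightarrow> bool" where
  "dominated_by M X C \<phi> \<psi> \<longleftrightarrow>
     (\<forall>\<theta>\<in>C - {0}. \<forall>\<Sigma>\<in>pos_def. power_fn M X \<phi> \<theta> \<Sigma> \<le> power_fn M X \<psi> \<theta> \<Sigma>)"

end

theory Submission
  imports Defs
begin

text \<open>
  For a closed cone \<open>C\<close> the squared norm of the projection of \<open>z\<close> onto \<open>C\<close> is the supremum of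
  \<open>2 \<langle>z, y\<rangle> - \<langle>y, y\<rangle>\<close> over \<open>y \<in> C\<close>. Hence the statistic \<open>T C\<close> is monotone in \<open>C\<close>, lower semicontinuous
  in the sample, and \<open>T C (L x) = T (L\<^sup>-\<^sup>1 C) x\<close> for invertible \<open>L\<close>. By monotonicity it suffices to
  show \<open>c' \<le> c\<close> for the critical values.

  At \<open>\<theta> = 0\<close> the law of \<open>T H\<close>, \<open>H\<close> the half-space, does not depend on \<open>\<Sigma>\<close>, because every positive
  definite \<open>\<Sigma>\<close> is \<open>L L\<^sup>T\<close> for some \<open>L\<close> preserving \<open>H\<close> (Gram-Schmidt with respect to \<open>\<Sigma>\<close>, starting with the last
  basis vector). Since \<open>C\<close> has an interior point, it contains linear images of cones exhausting the
  interior of \<open>H\<close>, so the supremum over \<open>\<Sigma>\<close> of the size of the test for \<open>C\<close> at \<open>c\<close> is at least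
  \<open>P (T H > c)\<close>. If \<open>c < c'\<close>, this exceeds \<open>P (T H \<ge> c') = \<alpha>\<close>, since \<open>c < T H < c'\<close> holds on a nonempty
  open set of samples.
\<close>

section \<open>Positive definite matrices\<close>

lemma matrix_inv_mult:
  fixes A :: "real ^ 'n ^ 'n :: finite"
  assumes "invertible A"
  shows "A ** matrix_inv A = mat 1" "matrix_inv A ** A = mat 1"
proof -
  have "A ** matrix_inv A = mat 1 \<and> matrix_inv A ** A = mat 1"
    using assms unfolding matrix_inv_def invertible_def by (rule someI_ex)
  then show "A ** matrix_inv A = mat 1" "matrix_inv A ** A = mat 1" by auto
qed

lemma invertible_congruence:
  fixes L S :: "real ^ 'n ^ 'n :: finite"
  assumes "invertible L"
  shows "invertible (L ** S ** transpose L) \<longleftrightarrow> invertible S"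
  using assms by (simp add: invertible_det_nz det_mul)

text \<open>The inverse of the congruent matrix is never computed: \<open>?w\<close> solves
  \<open>?A *v ?w = L *v y\<close>, and cancelling \<open>L\<close> and then \<open>S\<close> leaves
  \<open>transpose L *v ?w = matrix_inv S *v y\<close>.\<close>

lemma inner_wrt_congruence:
  fixes L S :: "real ^ 'n ^ 'n :: finite"
  assumes L: "invertible L" and S: "invertible S"
  shows "inner_wrt (L ** S ** transpose L) (L *v x) (L *v y) = inner_wrt S x y"
proof -
  let ?A = "L ** S ** transpose L"
  let ?w = "matrix_inv ?A *v (L *v y)"
  have A: "invertible ?A" using invertible_congruence[OF L] S by simp
  have "?A *v ?w = (?A ** matrix_inv ?A) *v (L *v y)"
    by (simp only: matrix_vector_mul_assoc matrix_mul_assoc)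
  also have "\<dots> = L *v y"
    by (simp only: matrix_inv_mult(1)[OF A] matrix_vector_mul_lid)
  finally have "?A *v ?w = L *v y" .
  then have "matrix_inv S *v (matrix_inv L *v (?A *v ?w)) = matrix_inv S *v y"
    by (simp add: matrix_vector_mul_assoc matrix_inv_mult[OF L] del: transpose_matrix_vector)
  then have "transpose L *v ?w = matrix_inv S *v y"
    by (simp add: matrix_vector_mul_assoc matrix_mul_assoc matrix_inv_mult[OF L] matrix_inv_mult[OF S] del: transpose_matrix_vector)
  then show ?thesis
    unfolding inner_wrt_def by (metis dot_lmul_matrix inner_commute transpose_matrix_vector)
qed

lemma inner_wrt_mat_1 [simp]: "inner_wrt (mat 1) x (y :: real ^ 'n :: finite) = x \<bullet> y"
proof -
  have "invertible (mat 1 :: real ^ 'n ^ 'n)" by (simp add: invertible_det_nz)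
  from matrix_inv_mult(1)[OF this] show ?thesis by (simp add: inner_wrt_def)
qed

lemma pos_def_invertible: "A \<in> pos_def \<Longrightarrow> invertible A"
proof -
  assume A: "A \<in> pos_def"
  have "x = 0" if "A *v x = 0" for x
    using A that unfolding pos_def_def by force
  then show "invertible A"
    unfolding invertible_left_inverse matrix_left_invertible_ker by blast
qed

lemma pos_def_mat_1: "mat 1 \<in> pos_def"
  by (simp add: pos_def_def transpose_mat)

lemma inner_congruence:
  fixes L S :: "real ^ 'n ^ 'n :: finite"
  shows "x \<bullet> ((L ** S ** transpose L) *v y) = (transpose L *v x) \<bullet> (S *v (transpose L *v y))"
  by (simp add: matrix_vector_mul_assoc[symmetric] dot_lmul_matrix del: transpose_matrix_vector)
     (simp add: dot_lmul_matrix)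

lemma pos_def_congruence:
  fixes L S :: "real ^ 'n ^ 'n :: finite"
  assumes "invertible L" "S \<in> pos_def"
  shows "L ** S ** transpose L \<in> pos_def"
proof -
  have "transpose L *v x \<noteq> 0" if "x \<noteq> 0" for x
    using transpose_invertible[OF assms(1)] that
    by (metis invertible_left_inverse matrix_left_invertible_ker)
  then show ?thesis
    using assms(2) by (simp add: pos_def_def inner_congruence matrix_transpose_mul matrix_mul_assoc del: transpose_matrix_vector)
qed

text \<open>Induction on the index set, starting from a multiple of \<open>axis k 1\<close>, builds
  a basis that is orthonormal for the form \<open>x \<bullet> (A *v y)\<close>. Prescribing the
  direction of \<open>b k\<close> is what controls coordinate \<open>k\<close> in the factorization
  below.\<close>

lemma gram_schmidt_wrt:
  fixes A :: "real ^ 'n ^ 'n :: finite" and k :: 'n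
  assumes A: "A \<in> pos_def"
  shows "\<exists>b :: 'n \<Rightarrow> real ^ 'n. (\<exists>a>0. b k = axis k a) \<and> (\<forall>i j. b i \<bullet> (A *v b j) = (if i = j then 1 else 0))"
proof -
  have sym: "x \<bullet> (A *v y) = y \<bullet> (A *v x)" for x y
    using A unfolding pos_def_def by (metis (mono_tags, lifting) dot_lmul_matrix inner_commute mem_Collect_eq transpose_matrix_vector)
  have pos: "0 < x \<bullet> (A *v x)" if "x \<noteq> 0" for x
    using A that by (simp add: pos_def_def)
  have normalize: "(inverse (sqrt q) *\<^sub>R w) \<bullet> (A *v (inverse (sqrt q) *\<^sub>R w)) = 1"
    if "w \<noteq> 0" "q = w \<bullet> (A *v w)" for w q
    using pos[OF that(1)] that(2)
    by (simp add: matrix_vector_mult_scaleR power2_eq_square[symmetric] field_simps)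
  have "finite J \<Longrightarrow> \<exists>b :: 'n \<Rightarrow> real ^ 'n. (\<exists>a>0. b k = axis k a) \<and>
      (\<forall>i\<in>insert k J. \<forall>j\<in>insert k J. b i \<bullet> (A *v b j) = (if i = j then 1 else 0))" for J
  proof (induction J rule: finite_induct)
    case empty
    define q where "q = (axis k 1 :: real ^ 'n) \<bullet> (A *v axis k 1)"
    have ne: "(axis k 1 :: real ^ 'n) \<noteq> 0" by (simp add: axis_eq_0_iff)
    have "q > 0" using pos[OF ne] by (simp add: q_def)
    moreover have "axis k (inverse (sqrt q)) = inverse (sqrt q) *\<^sub>R (axis k 1 :: real ^ 'n)"
      by (simp add: axis_def vec_eq_iff)
    ultimately show ?case
      using normalize[OF ne q_def]
      by (intro exI[of _ "\<lambda>_. axis k (inverse (sqrt q))"] conjI exI[of _ "inverse (sqrt q)"]) auto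
  next
    case (insert m J)
    then obtain b a where a: "a > 0" "b k = axis k a" and b: "\<And>i j. i \<in> insert k J \<Longrightarrow> j \<in> insert k J \<Longrightarrow>
      b i \<bullet> (A *v b j) = (if i = j then 1 else 0)" by metis
    show ?case
    proof (cases "m = k")
      case True
      then show ?thesis using insert.IH by simp
    next
      case False
      \<comment> \<open>Euclidean orthogonality to \<open>A *v b i\<close> is orthogonality to
        \<open>b i\<close> for the form of \<open>A\<close>. There are fewer than
        \<open>CARD('n)\<close> such vectors, so a nonzero \<open>w\<close> is orthogonal to all of
        them.\<close>
      let ?V = "(\<lambda>i. A *v b i) ` insert k J"
      have "insert k J \<subset> UNIV" using False insert.hyps by auto
      then have "card (insert k J) < CARD('n)" by (intro psubset_card_mono) auto
      then have "dim ?V < DIM(real ^ 'n)"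
        using insert.hyps card_image_le[of "insert k J" "\<lambda>i. A *v b i"] dim_le_card[of ?V ?V]
        by (auto simp: span_superset)
      then obtain w where w: "w \<noteq> 0" "\<And>y. y \<in> span ?V \<Longrightarrow> orthogonal w y"
        using orthogonal_to_subspace_exists by blast
      have w0: "w \<bullet> (A *v b i) = 0" if "i \<in> insert k J" for i
        using w(2)[OF span_base, of "A *v b i"] that by (auto simp: orthogonal_def)
      define q where "q = w \<bullet> (A *v w)"
      define b' where "b' = b(m := inverse (sqrt q) *\<^sub>R w)"
      have "m \<notin> insert k J" using insert.hyps False by auto
      then have "b' i \<bullet> (A *v b' j) = (if i = j then 1 else 0)"
        if "i \<in> insert m (insert k J)" "j \<in> insert m (insert k J)" for i j
        using that b[of i j] w0[of i] w0[of j] normalize[OF w(1) q_def] sym[of "b i" w]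
        by (auto simp: b'_def matrix_vector_mult_scaleR)
      moreover have "b' k = axis k a" using a False by (simp add: b'_def)
      ultimately show ?thesis using a(1) by (intro exI[of _ b']) (simp add: insert_commute, blast)
    qed
  qed
  from this[of UNIV] show ?thesis by auto
qed

text \<open>The matrix \<open>B\<close> with rows \<open>b i\<close> satisfies
  \<open>B ** A ** transpose B = mat 1\<close>, and \<open>L\<close> is its inverse. Row
  \<open>k\<close> of \<open>B\<close> is \<open>axis k a\<close>, so \<open>B\<close> and
  \<open>L\<close> only rescale coordinate \<open>k\<close> by a positive factor. For the last
  index, such an \<open>L\<close> preserves the upper half-space.\<close>

lemma pos_def_factor:
  fixes A :: "real ^ 'n ^ 'n :: finite" and k :: 'n
  assumes A: "A \<in> pos_def"
  shows "\<exists>L a. invertible L \<and> A = L ** transpose L \<and> 0 < a \<and> (\<forall>x. (L *v x) $ k = a * x $ k)"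
proof -
  obtain b :: "'n \<Rightarrow> real ^ 'n" and a where a: "0 < a" "b k = axis k a"
    and b: "\<And>i j. b i \<bullet> (A *v b j) = (if i = j then 1 else 0)"
    using gram_schmidt_wrt[OF A, of k] by metis
  define B :: "real ^ 'n ^ 'n" where "B = (\<chi> i. b i)"
  have Bv: "(B *v x) $ i = b i \<bullet> x" for x i
    by (simp add: B_def matrix_vector_mul_component)
  have "(B ** A ** transpose B) $ i $ j = b i \<bullet> (A *v b j)" for i j
  proof -
    have "(B ** A ** transpose B) $ i $ j = axis i 1 \<bullet> ((B ** A ** transpose B) *v axis j 1)"
      by (simp add: inner_axis inner_axis' matrix_vector_mul_component)
    also have "\<dots> = b i \<bullet> (A *v b j)"
    proof -
      have "axis i 1 v* B = b i" for i
        by (simp add: vec_eq_iff vector_matrix_mult_def axis_def B_def if_distrib if_distribR cong: if_cong)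
      then show ?thesis by (simp add: inner_congruence)
    qed
    finally show ?thesis .
  qed
  then have one: "B ** A ** transpose B = mat 1" by (simp add: vec_eq_iff b mat_def)
  then have B: "invertible B"
    by (metis invertible_det_nz det_mul det_I mult_zero_left zero_neq_one)
  define L where "L = matrix_inv B"
  have LB: "L ** B = mat 1" "B ** L = mat 1" using matrix_inv_mult[OF B] by (auto simp: L_def)
  have L: "invertible L" using LB invertible_def by blast
  have "transpose B ** transpose L = mat 1" by (metis LB(1) matrix_transpose_mul transpose_mat)
  then have "L ** transpose L = A"
    by (metis LB(1) one matrix_mul_assoc matrix_mul_lid matrix_mul_rid)
  moreover have "(L *v x) $ k = inverse a * x $ k" for x
  proof -
    have "x $ k = (B *v (L *v x)) $ k" by (simp add: matrix_vector_mul_assoc LB)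
    also have "\<dots> = a * (L *v x) $ k" unfolding Bv by (simp add: a inner_axis')
    finally show ?thesis using a(1) by (simp add: field_simps)
  qed
  ultimately show ?thesis using L a(1) by (intro exI[of _ L] exI[of _ "inverse a"]) auto
qed

text \<open>The inverse \<open>K\<close> of a factor of \<open>A\<close> carries the inner product
  of \<open>A\<close> to the Euclidean one, where distances to closed sets are available.\<close>

lemma pos_def_inner_wrt_eq_inner:
  fixes A :: "real ^ 'n ^ 'n :: finite"
  assumes A: "A \<in> pos_def"
  shows "\<exists>K :: real ^ 'n ^ 'n. invertible K \<and> (\<forall>x y. inner_wrt A x y = (K *v x) \<bullet> (K *v y))"
proof -
  obtain L :: "real ^ 'n ^ 'n" where L: "invertible L" "A = L ** transpose L"
    using pos_def_factor[OF A] by blast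
  define K where "K = matrix_inv L"
  have LK: "L *v (K *v x) = x" for x
    using matrix_inv_mult[OF L(1)] by (simp add: K_def matrix_vector_mul_assoc)
  have "inner_wrt A x y = (K *v x) \<bullet> (K *v y)" for x y
    using inner_wrt_congruence[OF L(1) pos_def_invertible[OF pos_def_mat_1], of "K *v x" "K *v y"]
    by (simp add: LK L(2))
  moreover have "invertible K"
    unfolding K_def using matrix_inv_mult[OF L(1)] invertible_def by blast
  ultimately show ?thesis by blast
qed

section \<open>The statistic as a supremum\<close>

text \<open>For positive definite \<open>A\<close> this is the squared norm of \<open>z\<close>
  minus the squared distance from \<open>z\<close> to \<open>y\<close>, both with respect to
  \<open>A\<close>. Maximising it over \<open>y\<close> in a set is therefore projecting
  \<open>z\<close> onto that set.\<close>

definition gain :: "real ^ 'p ^ 'p \<Rightarrow> real ^ 'p \<Rightarrow> real ^ 'p :: finite \<Rightarrow> real" where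
  "gain A z y = 2 * inner_wrt A z y - inner_wrt A y y"

text \<open>The projection minimises the distance, hence maximises the gain. On a cone it is also
  optimal along its own ray, so its inner product with \<open>z\<close> is its squared norm, and the
  maximal gain equals that squared norm.\<close>

lemma norm_proj_gt_iff:
  fixes A :: "real ^ 'p ^ 'p :: finite"
  assumes A: "A \<in> pos_def" and C: "closed C" "cone C" "C \<noteq> {}"
  shows "t < (norm_wrt A (proj_wrt A C z))\<^sup>2 \<longleftrightarrow> (\<exists>y\<in>C. t < gain A z y)"
proof -
  obtain K :: "real ^ 'p ^ 'p" where K: "invertible K" and inner_K: "inner_wrt A x y = (K *v x) \<bullet> (K *v y)" for x y
    using pos_def_inner_wrt_eq_inner[OF A] by blast
  have norm_K: "norm_wrt A x = norm (K *v x)" for x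
    by (simp add: norm_wrt_def inner_K norm_eq_sqrt_inner)
  have gain_K: "gain A z y = (norm (K *v z))\<^sup>2 - (norm (K *v z - K *v y))\<^sup>2" for y
    by (simp add: gain_def inner_K power2_norm_eq_inner inner_diff_left inner_diff_right inner_commute)
  define f where "f = (\<lambda>y. norm_wrt A (z - y))"
  have f: "f y = norm (K *v z - K *v y)" for y
    by (simp add: f_def norm_K matrix_vector_mult_diff_distrib)
  have "inj ((*v) K)"
    using K unfolding invertible_left_inverse matrix_left_invertible_injective .
  then have "closed ((*v) K ` C)"
    using C(1) by (intro closed_injective_linear_image) auto
  moreover have "(*v) K ` C \<noteq> {}" using C(3) by simp
  ultimately obtain w where w: "w \<in> (*v) K ` C" "\<And>v. v \<in> (*v) K ` C \<Longrightarrow> dist (K *v z) w \<le> dist (K *v z) v"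
    by (rule distance_attains_inf[where a="K *v z"]) blast
  then obtain y0 where y0: "y0 \<in> C" "w = K *v y0" by blast
  have "f y0 \<le> f y" if "y \<in> C" for y
    using w(2)[OF imageI[OF that]] by (simp add: f dist_norm y0(2))
  then have "is_arg_min f (\<lambda>y. y \<in> C) y0"
    using y0(1) by (simp add: is_arg_min_linorder)
  then have "is_arg_min f (\<lambda>y. y \<in> C) (proj_wrt A C z)"
    unfolding proj_wrt_def arg_min_on_def arg_min_def f_def[symmetric] by (rule someI)
  then obtain \<pi> where \<pi>: "\<pi> = proj_wrt A C z" "\<pi> \<in> C" "\<And>y. y \<in> C \<Longrightarrow> f \<pi> \<le> f y"
    by (simp add: is_arg_min_linorder)
  let ?a = "K *v z" and ?b = "K *v \<pi>"
  \<comment> \<open>Minimality of \<open>\<pi>\<close> against its multiples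
    \<open>s *\<^sub>R \<pi>\<close>, which belong to the cone.\<close>
  have ray: "?b \<bullet> ?b - 2 * (?a \<bullet> ?b) \<le> s\<^sup>2 * (?b \<bullet> ?b) - 2 * s * (?a \<bullet> ?b)" if "s \<ge> 0" for s
  proof -
    have "(f \<pi>)\<^sup>2 \<le> (f (s *\<^sub>R \<pi>))\<^sup>2"
      using \<pi>(3)[of "s *\<^sub>R \<pi>"] C(2) \<pi>(2) that by (intro power_mono) (auto simp: cone_def f)
    then have "(norm (?a - ?b))\<^sup>2 \<le> (norm (?a - s *\<^sub>R ?b))\<^sup>2"
      by (simp add: f matrix_vector_mult_scaleR)
    then show ?thesis
      unfolding power2_norm_eq_inner
      by (simp add: inner_diff_left inner_diff_right inner_commute power2_eq_square algebra_simps)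
  qed
  have "?a \<bullet> ?b = ?b \<bullet> ?b"
  proof (cases "?b = 0")
    case False
    define p q where "p = ?a \<bullet> ?b" and "q = ?b \<bullet> ?b"
    have q: "q > 0" using False by (simp add: q_def)
    have ray': "q - 2 * p \<le> s\<^sup>2 * q - 2 * s * p" if "s \<ge> 0" for s
      using ray[OF that] by (simp add: p_def q_def)
    have p: "p > 0" using ray'[of 0] q by simp
    \<comment> \<open>The value \<open>s = p / q\<close> minimises the quadratic on the right of
      \<open>ray'\<close>; its minimum is \<open>- p\<^sup>2 / q\<close>.\<close>
    have "(p - q)\<^sup>2 \<le> 0"
      using ray'[of "p / q"] p q by (simp add: field_simps power2_eq_square)
    then show ?thesis by (simp add: p_def q_def)
  qed simp
  then have "(norm_wrt A \<pi>)\<^sup>2 = gain A z \<pi>"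
    by (simp add: norm_K gain_def inner_K power2_norm_eq_inner)
  moreover have "gain A z y \<le> gain A z \<pi>" if "y \<in> C" for y
    using \<pi>(3)[OF that] by (simp add: gain_K f power_mono)
  ultimately show ?thesis
    using \<pi>(1,2) by force
qed

lemma uit_statistic_nonneg: "0 \<le> uit_statistic n C x"
  by (simp add: uit_statistic_def Let_def)

text \<open>Strict inequality turns the supremum into an existential quantifier, and
  \<open>0 \<le> t\<close> excludes the samples on which the statistic takes its default value
  0.\<close>

lemma uit_statistic_gt_iff:
  assumes "closed C" "cone C" "C \<noteq> {}" and "0 \<le> t"
  shows "t < uit_statistic n C x \<longleftrightarrow> sample_cov n x \<in> pos_def \<and>
    (\<exists>y\<in>C. t < gain (sample_cov n x) (sqrt (real n) *\<^sub>R sample_mean n x) y)"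
  using assms by (auto simp: uit_statistic_def Let_def norm_proj_gt_iff)

text \<open>A larger cone offers more witnesses \<open>y\<close>; the contradiction takes the
  statistic for \<open>D\<close> itself as the threshold.\<close>

lemma uit_statistic_mono:
  assumes "closed C" "cone C" "C \<noteq> {}" "closed D" "cone D" "C \<subseteq> D"
  shows "uit_statistic n C x \<le> uit_statistic n D x"
proof (rule ccontr)
  assume "\<not> ?thesis"
  then have "uit_statistic n D x < uit_statistic n C x" by simp
  then have "uit_statistic n D x < uit_statistic n D x"
    using assms uit_statistic_nonneg[of n D x]
    by (subst uit_statistic_gt_iff) (auto simp: uit_statistic_gt_iff)
  then show False by simp
qed

section \<open>Sample mean and covariance under linear maps\<close>

lemma outer_square_mult_vec: "outer_square u *v v = (u \<bullet> v) *\<^sub>R u"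
  by (simp add: vec_eq_iff outer_square_def matrix_vector_mult_def inner_vec_def sum_distrib_left
      sum_distrib_right mult_ac)

lemma sample_cov_mult_vec:
  "sample_cov n x *v v = (1 / (real n - 1)) *\<^sub>R
     (\<Sum>i=1..n. ((x i - sample_mean n x) \<bullet> v) *\<^sub>R (x i - sample_mean n x))"
proof -
  have "(\<Sum>i\<in>I. f i) *v v = (\<Sum>i\<in>I. f i *v v)" for f :: "nat \<Rightarrow> real ^ 'a ^ 'a" and I
    by (induction I rule: infinite_finite_induct) (auto simp: matrix_vector_mult_add_rdistrib)
  then show ?thesis
    by (simp add: sample_cov_def scaleR_matrix_vector_assoc[symmetric] outer_square_mult_vec)
qed

lemma transpose_sample_cov: "transpose (sample_cov n x) = sample_cov n x"
  by (simp add: vec_eq_iff sample_cov_def outer_square_def transpose_def mult.commute)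

lemma inner_sample_cov:
  "v \<bullet> (sample_cov n x *v v) = (\<Sum>i=1..n. ((x i - sample_mean n x) \<bullet> v)\<^sup>2) / (real n - 1)"
  by (simp add: sample_cov_mult_vec inner_sum_right power2_eq_square inner_commute)

text \<open>The sample covariance is always positive semidefinite. If its quadratic form vanishes at
  \<open>v\<close>, every centred observation is orthogonal to \<open>v\<close>, so \<open>v\<close>
  lies in the kernel.\<close>

lemma sample_cov_pos_def_iff:
  assumes "2 \<le> n"
  shows "sample_cov n x \<in> pos_def \<longleftrightarrow> det (sample_cov n x) \<noteq> 0"
proof
  assume "det (sample_cov n x) \<noteq> 0"
  then have inv: "invertible (sample_cov n x)" by (simp add: invertible_det_nz)
  have "0 < v \<bullet> (sample_cov n x *v v)" if "v \<noteq> 0" for v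
  proof (rule ccontr)
    assume "\<not> ?thesis"
    then have "(\<Sum>i=1..n. ((x i - sample_mean n x) \<bullet> v)\<^sup>2) \<le> 0"
      using assms by (simp add: inner_sample_cov field_simps not_less)
    then have "(\<Sum>i=1..n. ((x i - sample_mean n x) \<bullet> v)\<^sup>2) = 0"
      by (intro antisym sum_nonneg) auto
    then have "\<forall>i\<in>{1..n}. (x i - sample_mean n x) \<bullet> v = 0"
      by (subst (asm) sum_nonneg_eq_0_iff) auto
    then have "sample_cov n x *v v = 0" by (simp add: sample_cov_mult_vec)
    then show False
      using inv that by (metis invertible_left_inverse matrix_left_invertible_ker)
  qed
  then show "sample_cov n x \<in> pos_def"
    by (simp add: pos_def_def transpose_sample_cov)
qed (use pos_def_invertible invertible_det_nz in blast)

lemma sample_mean_linear: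
  "sample_mean n (\<lambda>i. L *v x i) = L *v sample_mean n x"
  by (simp add: sample_mean_def matrix_vector_mult_scaleR linear_sum[OF matrix_vector_mul_linear])

lemma sample_cov_linear:
  "sample_cov n (\<lambda>i. L *v x i) = L ** sample_cov n x ** transpose L"
proof -
  have "sample_cov n (\<lambda>i. L *v x i) *v v = (L ** sample_cov n x ** transpose L) *v v" for v
  proof -
    have "(L *v x i - L *v m) \<bullet> v = (x i - m) \<bullet> (v v* L)" for i m
      by (metis dot_lmul_matrix inner_commute matrix_vector_mult_diff_distrib)
    then show ?thesis
      by (simp add: sample_cov_mult_vec sample_mean_linear matrix_vector_mul_assoc[symmetric]
          matrix_vector_mult_scaleR linear_sum[OF matrix_vector_mul_linear] matrix_vector_mult_diff_distrib)
  qed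
  then show ?thesis by (simp add: matrix_eq)
qed

lemma closed_cone_linear_vimage:
  fixes L :: "real ^ 'p ^ 'p :: finite"
  assumes "closed C" "cone C" "C \<noteq> {}"
  shows "closed ((*v) L -` C)" "cone ((*v) L -` C)" "(*v) L -` C \<noteq> {}"
proof -
  show "closed ((*v) L -` C)"
    using assms(1) by (intro closed_vimage) (auto intro: matrix_vector_mult_linear_continuous_on)
  show "cone ((*v) L -` C)"
    using assms(2) by (auto simp: cone_def matrix_vector_mult_scaleR)
  have "0 \<in> C" using assms(2,3) cone_contains_0 by blast
  then have "0 \<in> (*v) L -` C" by simp
  then show "(*v) L -` C \<noteq> {}" by blast
qed

text \<open>The gain is unchanged when the mean, the covariance and \<open>y\<close> are transformed
  together by \<open>L\<close>; letting \<open>y\<close> range over \<open>C\<close> then amounts to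
  letting its preimage under \<open>L\<close> range over the preimage of \<open>C\<close>.\<close>

lemma uit_statistic_linear:
  fixes L :: "real ^ 'p ^ 'p :: finite"
  assumes n: "2 \<le> n" and C: "closed C" "cone C" "C \<noteq> {}" and L: "invertible L"
  shows "uit_statistic n C (\<lambda>i. L *v x i) = uit_statistic n ((*v) L -` C) x"
proof -
  let ?S = "sample_cov n x" and ?z = "sqrt (real n) *\<^sub>R sample_mean n x"
  have pd: "L ** ?S ** transpose L \<in> pos_def \<longleftrightarrow> ?S \<in> pos_def"
    using invertible_congruence[OF L, of ?S]
    unfolding sample_cov_linear[symmetric] sample_cov_pos_def_iff[OF n] by (simp add: invertible_det_nz)
  have surj: "y = L *v (matrix_inv L *v y)" for y
    by (simp add: matrix_vector_mul_assoc matrix_inv_mult[OF L])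
  have ex: "(\<exists>y\<in>C. P y) \<longleftrightarrow> (\<exists>y\<in>(*v) L -` C. P (L *v y))" for P
    using surj by (metis vimage_eq)
  have gain: "gain (L ** ?S ** transpose L) (L *v z) (L *v y) = gain ?S z y" if "?S \<in> pos_def" for z y
    by (simp add: gain_def inner_wrt_congruence[OF L pos_def_invertible[OF that]])
  have "t < uit_statistic n C (\<lambda>i. L *v x i) \<longleftrightarrow> t < uit_statistic n ((*v) L -` C) x" if "t \<ge> 0" for t
    unfolding uit_statistic_gt_iff[OF C that] uit_statistic_gt_iff[OF closed_cone_linear_vimage[OF C] that]
      sample_mean_linear sample_cov_linear pd ex
    using gain by (auto simp: matrix_vector_mult_scaleR[symmetric])
  then show ?thesis
    using uit_statistic_nonneg by (meson less_irrefl linorder_cases)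
qed

section \<open>Continuity in the sample\<close>

lemma continuous_on_det:
  fixes A :: "'a :: topological_space \<Rightarrow> real ^ 'p ^ 'p :: finite"
  assumes "\<And>i j. continuous_on V (\<lambda>x. A x $ i $ j)"
  shows "continuous_on V (\<lambda>x. det (A x))"
  unfolding det_def by (intro continuous_intros assms)

text \<open>By Cramer's rule the vector \<open>matrix_inv (A x) *v v x\<close> is a quotient of
  determinants whose entries are continuous.\<close>

lemma continuous_on_inner_wrt:
  fixes A :: "'a :: topological_space \<Rightarrow> real ^ 'p ^ 'p :: finite"
  assumes "continuous_on V A" "continuous_on V u" "continuous_on V v"
    and det: "\<And>x. x \<in> V \<Longrightarrow> det (A x) \<noteq> 0"
  shows "continuous_on V (\<lambda>x. inner_wrt (A x) (u x) (v x))"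
proof -
  let ?R = "\<lambda>x k. (\<chi> i j. if j = k then v x $ i else A x $ i $ j)"
  have A: "continuous_on V (\<lambda>x. A x $ i $ j)" for i j
    using assms(1) by (intro continuous_intros)
  have "continuous_on V (\<lambda>x. ?R x k $ i $ j)" for i j k
    using A assms(3) by (cases "j = k") (auto intro!: continuous_intros)
  then have "continuous_on V (\<lambda>x. u x \<bullet> (\<chi> k. det (?R x k) / det (A x)))"
    using A det assms(1,2) by (intro continuous_intros continuous_on_vec_lambda continuous_on_det) auto
  moreover have "matrix_inv (A x) *v v x = (\<chi> k. det (?R x k) / det (A x))" if "x \<in> V" for x
  proof -
    have "A x *v (matrix_inv (A x) *v v x) = v x"
      using det[OF that] by (simp add: matrix_vector_mul_assoc matrix_inv_mult invertible_det_nz)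
    then show ?thesis using cramer[OF det[OF that]] by blast
  qed
  ultimately show ?thesis
    by (simp add: inner_wrt_def cong: continuous_on_cong)
qed

lemma continuous_on_sample_mean: "continuous_on V (sample_mean n :: (nat \<Rightarrow> real ^ 'p :: finite) \<Rightarrow> _)"
  unfolding sample_mean_def
  by (intro continuous_intros continuous_on_subset[OF continuous_on_product_coordinates]) auto

lemma continuous_on_sample_cov: "continuous_on V (sample_cov n :: (nat \<Rightarrow> real ^ 'p :: finite) \<Rightarrow> _)"
  unfolding sample_cov_def outer_square_def
  by (intro continuous_intros continuous_on_vec_lambda continuous_on_sample_mean
       continuous_on_subset[OF continuous_on_product_coordinates]) auto

lemma open_det_sample_cov: "open {x :: nat \<Rightarrow> real ^ 'p :: finite. det (sample_cov n x) \<noteq> 0}"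
  by (intro open_Collect_neq continuous_on_det continuous_intros continuous_on_sample_cov)

text \<open>The point \<open>y\<close> may vary with the sample: a constant \<open>y\<close> gives
  lower semicontinuity of the statistic, and the scaled mean as \<open>y\<close> gives the open set
  on which the half-space statistic is squeezed between two bounds.\<close>

lemma open_sample_gain:
  fixes y :: "(nat \<Rightarrow> real ^ 'p) \<Rightarrow> real ^ 'p :: finite"
  assumes "continuous_on UNIV y" "open T"
  shows "open {x. det (sample_cov n x) \<noteq> 0 \<and>
    gain (sample_cov n x) (sqrt (real n) *\<^sub>R sample_mean n x) (y x) \<in> T}"
proof -
  let ?V = "{x :: nat \<Rightarrow> real ^ 'p. det (sample_cov n x) \<noteq> 0}"
  let ?g = "\<lambda>x. gain (sample_cov n x) (sqrt (real n) *\<^sub>R sample_mean n x) (y x)"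
  have "continuous_on ?V ?g"
    unfolding gain_def using assms(1)
    by (intro continuous_intros continuous_on_inner_wrt continuous_on_sample_cov continuous_on_sample_mean)
       (auto intro: continuous_on_subset)
  then have "open (?V \<inter> ?g -` T)"
    using open_det_sample_cov assms(2) by (rule continuous_open_preimage)
  then show ?thesis by (simp add: vimage_def Collect_conj_eq)
qed

text \<open>The set is a union, over \<open>y\<close> in the cone, of open sets. This is the source
  of Borel measurability of the statistic.\<close>

lemma open_uit_statistic_gt:
  assumes "2 \<le> n" "closed C" "cone C" "C \<noteq> {}" "0 \<le> t"
  shows "open {x. t < uit_statistic n C x}"
proof -
  have "{x. t < uit_statistic n C x} = (\<Union>y\<in>C. {x. det (sample_cov n x) \<noteq> 0 \<and>
    gain (sample_cov n x) (sqrt (real n) *\<^sub>R sample_mean n x) y \<in> {t<..}})"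
    using assms by (auto simp: uit_statistic_gt_iff sample_cov_pos_def_iff)
  then show ?thesis
    using open_sample_gain[of "\<lambda>_. _" "{t<..}" n] by (auto intro!: open_UN)
qed

section \<open>Normal samples\<close>

lemma borel_measurable_matrix_vector_mult:
  "(*v) (L :: real ^ 'p ^ 'p :: finite) \<in> borel_measurable borel"
  by (intro borel_measurable_continuous_onI matrix_vector_mult_linear_continuous_on)

lemma nn_integral_lborel_plus:
  fixes f :: "'a :: euclidean_space \<Rightarrow> ennreal"
  assumes [measurable]: "f \<in> borel_measurable borel"
  shows "(\<integral>\<^sup>+x. f (a + x) \<partial>lborel) = (\<integral>\<^sup>+x. f x \<partial>lborel)"
proof -
  have "(\<integral>\<^sup>+x. f x \<partial>lborel) = (\<integral>\<^sup>+x. f x \<partial>distr lborel borel ((+) a))"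
    by (simp add: lborel_distr_plus)
  then show ?thesis by (simp add: nn_integral_distr)
qed

text \<open>
  Uniqueness of translation-invariant measures, via Fubini: both the image of Lebesgue measure under
  \<open>L\<close> and Lebesgue measure are translation invariant. (The change of variables theorems of the library
  need a well-ordered index type.)
\<close>
lemma nn_integral_lborel_linear:
  fixes L :: "real ^ 'p ^ 'p :: finite" and f g :: "real ^ 'p \<Rightarrow> ennreal"
  assumes L: "invertible L"
    and f [measurable]: "f \<in> borel_measurable borel"
    and g [measurable]: "g \<in> borel_measurable borel"
  shows "(\<integral>\<^sup>+x. f (L *v x) \<partial>lborel) * (\<integral>\<^sup>+y. g y \<partial>lborel) =
    (\<integral>\<^sup>+x. g (- (L *v x)) \<partial>lborel) * (\<integral>\<^sup>+y. f y \<partial>lborel)"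
proof -
  note [measurable] = borel_measurable_matrix_vector_mult[of L]
  define K where "K = matrix_inv L"
  have LK: "L *v (K *v x) = x" for x
    using matrix_inv_mult[OF L] by (simp add: K_def matrix_vector_mul_assoc)
  have fL: "(\<integral>\<^sup>+x. f (y + L *v x) \<partial>lborel) = (\<integral>\<^sup>+x. f (L *v x) \<partial>lborel)" for y
    using nn_integral_lborel_plus[of "\<lambda>x. f (L *v x)" "K *v y"]
    by (simp add: matrix_vector_right_distrib LK)
  have gL: "(\<integral>\<^sup>+x. g (y - L *v x) \<partial>lborel) = (\<integral>\<^sup>+x. g (- (L *v x)) \<partial>lborel)" for y
    using nn_integral_lborel_plus[of "\<lambda>x. g (- (L *v x))" "- (K *v y)"]
    by (simp add: matrix_vector_mult_diff_distrib matrix_vector_right_distrib LK minus_diff_eq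
        linear_neg[OF matrix_vector_mul_linear])
  have shift: "(\<integral>\<^sup>+y. g y * f (y + L *v x) \<partial>lborel) = (\<integral>\<^sup>+y. g (y - L *v x) * f y \<partial>lborel)" for x
    using nn_integral_lborel_plus[of "\<lambda>y. g (y - L *v x) * f y" "L *v x"] by (simp add: add.commute)
  have "(\<integral>\<^sup>+x. f (L *v x) \<partial>lborel) * (\<integral>\<^sup>+y. g y \<partial>lborel) =
      (\<integral>\<^sup>+y. g y * (\<integral>\<^sup>+x. f (y + L *v x) \<partial>lborel) \<partial>lborel)"
    unfolding fL by (simp add: nn_integral_multc mult.commute)
  also have "\<dots> = (\<integral>\<^sup>+y. \<integral>\<^sup>+x. g y * f (y + L *v x) \<partial>lborel \<partial>lborel)"
    by (intro nn_integral_cong nn_integral_cmult[symmetric]) simp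
  also have "\<dots> = (\<integral>\<^sup>+x. \<integral>\<^sup>+y. g y * f (y + L *v x) \<partial>lborel \<partial>lborel)"
    by (intro lborel_pair.Fubini') simp
  also have "\<dots> = (\<integral>\<^sup>+x. \<integral>\<^sup>+y. g (y - L *v x) * f y \<partial>lborel \<partial>lborel)"
    by (simp add: shift)
  also have "\<dots> = (\<integral>\<^sup>+y. \<integral>\<^sup>+x. g (y - L *v x) * f y \<partial>lborel \<partial>lborel)"
    by (intro lborel_pair.Fubini') simp
  also have "\<dots> = (\<integral>\<^sup>+y. (\<integral>\<^sup>+x. g (- (L *v x)) \<partial>lborel) * f y \<partial>lborel)"
    by (simp add: nn_integral_multc gL)
  also have "\<dots> = (\<integral>\<^sup>+x. g (- (L *v x)) \<partial>lborel) * (\<integral>\<^sup>+y. f y \<partial>lborel)"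
    by (simp add: nn_integral_cmult)
  finally show ?thesis .
qed

lemma borel_measurable_mvnormal_density:
  assumes "invertible \<Sigma>"
  shows "mvnormal_density \<theta> \<Sigma> \<in> borel_measurable borel"
proof -
  have "continuous_on UNIV (\<lambda>x. inner_wrt \<Sigma> (x - \<theta>) (x - \<theta>))"
    using assms unfolding invertible_det_nz by (intro continuous_on_inner_wrt continuous_intros)
  then show ?thesis
    unfolding mvnormal_density_def by (intro borel_measurable_continuous_onI) (intro continuous_intros, use assms in \<open>simp_all add: invertible_det_nz\<close>)
qed

lemma mvnormal_density_pos:
  fixes \<Sigma> :: "real ^ 'p ^ 'p :: finite"
  assumes "\<Sigma> \<in> pos_def"
  shows "0 < mvnormal_density \<theta> \<Sigma> x"
proof -
  obtain L :: "real ^ 'p ^ 'p" where "invertible L" "\<Sigma> = L ** transpose L"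
    using pos_def_factor[OF assms] by blast
  then have "0 < det \<Sigma>" by (simp add: det_mul det_transpose invertible_det_nz zero_less_mult_iff linorder_neq_iff disj_commute)
  then show ?thesis by (simp add: mvnormal_density_def)
qed

text \<open>The densities satisfy \<open>\<phi> x = \<bar>det L\<bar> * \<psi> (L x)\<close>, so the
  image measure is a constant multiple of the measure with density \<open>\<psi>\<close>. Both have
  total mass 1, which forces the constant to be 1.\<close>

lemma distr_mvnormal_linear:
  fixes L :: "real ^ 'p ^ 'p :: finite"
  defines "\<phi> \<equiv> \<lambda>x. ennreal (mvnormal_density 0 (mat 1) x)"
    and "\<psi> \<equiv> \<lambda>x. ennreal (mvnormal_density 0 (L ** transpose L) x)"
  assumes L: "invertible L"
    and \<phi>: "(\<integral>\<^sup>+x. \<phi> x \<partial>lborel) = 1" and \<psi>: "(\<integral>\<^sup>+x. \<psi> x \<partial>lborel) = 1"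
  shows "distr (density lborel \<phi>) borel ((*v) L) = density lborel \<psi>"
proof -
  note [measurable] = borel_measurable_matrix_vector_mult[of L]
  have one: "invertible (mat 1 :: real ^ 'p ^ 'p)" by (simp add: invertible_det_nz)
  have "invertible (L ** transpose L)"
    using L by (simp add: invertible_mult transpose_invertible)
  note [measurable] = borel_measurable_mvnormal_density[OF this] borel_measurable_mvnormal_density[OF one]
  have [measurable]: "\<phi> \<in> borel_measurable borel" "\<psi> \<in> borel_measurable borel"
    unfolding \<phi>_def \<psi>_def by measurable
  define c where "c = ennreal \<bar>det L\<bar> * (\<integral>\<^sup>+x. \<phi> (- (L *v x)) \<partial>lborel)"
  have d: "\<phi> x = ennreal \<bar>det L\<bar> * \<psi> (L *v x)" for x
    using inner_wrt_congruence[OF L one, of x x] L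
    by (simp add: \<phi>_def \<psi>_def mvnormal_density_def det_mul det_transpose real_sqrt_mult invertible_det_nz
        ennreal_mult'[symmetric])
  \<comment> \<open>The identity \<open>nn_integral_lborel_linear\<close> with \<open>\<phi>\<close>
    as the second function: its integral is 1, and the factor \<open>c\<close> does not depend on
    \<open>A\<close>.\<close>
  have key: "(\<integral>\<^sup>+x. \<phi> x * indicator A (L *v x) \<partial>lborel) = c * (\<integral>\<^sup>+x. \<psi> x * indicator A x \<partial>lborel)"
    if [measurable]: "A \<in> sets borel" for A
    using nn_integral_lborel_linear[OF L, of "\<lambda>x. \<psi> x * indicator A x" \<phi>]
    by (simp add: d[abs_def] c_def nn_integral_cmult mult.assoc \<phi>[unfolded d])
  have "c = 1" using key[of UNIV] by (simp add: \<phi> \<psi>)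
  show ?thesis
  proof (rule measure_eqI)
    fix A assume "A \<in> sets (distr (density lborel \<phi>) borel ((*v) L))"
    then have [measurable]: "A \<in> sets borel" by simp
    have [measurable]: "(*v) L -` A \<in> sets borel"
      using measurable_sets[OF borel_measurable_matrix_vector_mult[of L], of A] by simp
    show "emeasure (distr (density lborel \<phi>) borel ((*v) L)) A = emeasure (density lborel \<psi>) A"
      using key[of A] \<open>c = 1\<close>
      by (simp add: emeasure_distr emeasure_density indicator_vimage[symmetric] indicator_def)
  qed simp
qed

text \<open>A sample is a function on all of \<open>nat\<close>, but nothing is known about
  \<open>X i\<close> for \<open>i\<close> outside \<open>{1..n}\<close>, not even measurability.
  Events with this property do not see those coordinates.\<close>

definition depends_on_sample :: "nat \<Rightarrow> (nat \<Rightarrow> 'b) set \<Rightarrow> bool" where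
  "depends_on_sample n E \<longleftrightarrow> (\<forall>x y. (\<forall>i\<in>{1..n}. x i = y i) \<longrightarrow> x \<in> E \<longrightarrow> y \<in> E)"

lemma depends_on_sampleD:
  "depends_on_sample n E \<Longrightarrow> x \<in> E \<Longrightarrow> (\<And>i. i \<in> {1..n} \<Longrightarrow> x i = y i) \<Longrightarrow> y \<in> E"
  unfolding depends_on_sample_def by blast

lemma depends_on_sample_restrict:
  "depends_on_sample n E \<Longrightarrow> restrict x {1..n} \<in> E \<longleftrightarrow> x \<in> E"
  unfolding depends_on_sample_def by (metis restrict_apply')

text \<open>Functions in the product over \<open>I\<close> have the constant value
  \<open>undefined\<close> off \<open>I\<close>. Hence the inclusion into the countable product over
  \<open>nat\<close> is measurable, and there the product and Borel sets agree.\<close>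

lemma measurable_PiM_borel_inclusion:
  fixes I :: "nat set"
  shows "(\<lambda>x. x) \<in> PiM I (\<lambda>_. borel :: (real ^ 'p :: finite) measure) \<rightarrow>\<^sub>M borel"
proof -
  let ?P = "PiM I (\<lambda>_. borel :: (real ^ 'p) measure)"
  have "(\<lambda>x. x i) \<in> ?P \<rightarrow>\<^sub>M borel" for i
  proof (cases "i \<in> I")
    case False
    then have "x i = undefined" if "x \<in> space ?P" for x
      using that by (auto simp: space_PiM PiE_def extensional_def)
    then show ?thesis by (subst measurable_cong[where g="\<lambda>_. undefined"]) auto
  qed simp
  then have "(\<lambda>x i. x i) \<in> ?P \<rightarrow>\<^sub>M PiM UNIV (\<lambda>_. borel)"
    by (intro measurable_PiM_single') auto
  then show ?thesis
    using measurable_cong_sets[OF refl sets_PiM_equal_borel] by auto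
qed

text \<open>The event is the preimage of a product-measurable set under the restricted sample, so
  its probability is determined by the joint law of \<open>X 1\<close>, ...,
  \<open>X n\<close>.\<close>

lemma
  fixes E :: "(nat \<Rightarrow> real ^ 'p :: finite) set"
  assumes E: "E \<in> sets borel" "depends_on_sample n E"
    and X: "\<And>i. i \<in> {1..n} \<Longrightarrow> X i \<in> borel_measurable M"
  shows sets_sample_event: "{\<omega> \<in> space M. (\<lambda>i. X i \<omega>) \<in> E} \<in> sets M"
    and measure_sample_event: "measure M {\<omega> \<in> space M. (\<lambda>i. X i \<omega>) \<in> E} =
      measure (distr M (PiM {1..n} (\<lambda>_. borel)) (\<lambda>\<omega>. \<lambda>i\<in>{1..n}. X i \<omega>))
        (E \<inter> space (PiM {1..n} (\<lambda>_. borel)))"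
proof -
  let ?P = "PiM {1..n} (\<lambda>_. borel :: (real ^ 'p) measure)"
  let ?r = "\<lambda>\<omega>. \<lambda>i\<in>{1..n}. X i \<omega>"
  have r: "?r \<in> M \<rightarrow>\<^sub>M ?P" using X by (rule measurable_restrict)
  have E': "E \<inter> space ?P \<in> sets ?P"
    using measurable_sets[OF measurable_PiM_borel_inclusion E(1)] by simp
  have "{\<omega> \<in> space M. (\<lambda>i. X i \<omega>) \<in> E} = ?r -` (E \<inter> space ?P) \<inter> space M"
    using measurable_space[OF r] depends_on_sample_restrict[OF E(2)] by auto
  then show "{\<omega> \<in> space M. (\<lambda>i. X i \<omega>) \<in> E} \<in> sets M"
    "measure M {\<omega> \<in> space M. (\<lambda>i. X i \<omega>) \<in> E} = measure (distr M ?P ?r) (E \<inter> space ?P)"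
    using measurable_sets[OF r E'] measure_distr[OF r E'] by simp_all
qed

lemma iid_normal_distr:
  assumes "iid_normal n M X \<theta> \<Sigma>" "i \<in> {1..n}"
  shows "X i \<in> borel_measurable M"
    "distr M borel (X i) = density lborel (\<lambda>x. ennreal (mvnormal_density \<theta> \<Sigma> x))"
proof -
  have D: "distributed M lborel (X i) (\<lambda>x. ennreal (mvnormal_density \<theta> \<Sigma> x))"
    using assms by (simp add: iid_normal_def)
  then show "X i \<in> borel_measurable M" by (simp add: distributed_def)
  have "distr M borel (X i) = distr M lborel (X i)" by (rule distr_cong) simp_all
  then show "distr M borel (X i) = density lborel (\<lambda>x. ennreal (mvnormal_density \<theta> \<Sigma> x))"
    using D by (simp add: distributed_def)
qed

text \<open>The density has mass 1 because it is the density of the law of the random vector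
  \<open>X n\<close>; no Gaussian integral is evaluated.\<close>

lemma iid_normal_nn_integral:
  assumes "iid_normal n M X \<theta> \<Sigma>" "1 \<le> n"
  shows "(\<integral>\<^sup>+x. ennreal (mvnormal_density \<theta> \<Sigma> x) \<partial>lborel) = 1"
proof -
  have n: "n \<in> {1..n}" using assms(2) by simp
  interpret prob_space M using assms(1) by (simp add: iid_normal_def)
  interpret D: prob_space "density lborel (\<lambda>x. ennreal (mvnormal_density \<theta> \<Sigma> x))"
    using prob_space_distr[OF iid_normal_distr(1)[OF assms(1) n]]
    unfolding iid_normal_distr(2)[OF assms(1) n] .
  have "distributed M lborel (X n) (\<lambda>x. ennreal (mvnormal_density \<theta> \<Sigma> x))"
    using assms(1) n by (simp add: iid_normal_def)
  then show ?thesis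
    using D.emeasure_space_1 by (simp add: emeasure_density distributed_def)
qed

text \<open>By independence both joint laws are products of their marginals, and each
  \<open>Y i\<close> has the law of \<open>L *v X i\<close>.\<close>

lemma measure_iid_normal_linear:
  fixes L :: "real ^ 'p ^ 'p :: finite"
  assumes M: "iid_normal n M X 0 (mat 1)" and N: "iid_normal n N Y 0 (L ** transpose L)"
    and n: "1 \<le> n" and L: "invertible L"
    and E: "E \<in> sets borel" "depends_on_sample n E"
  shows "measure N {\<omega> \<in> space N. (\<lambda>i. Y i \<omega>) \<in> E} = measure M {\<omega> \<in> space M. (\<lambda>i. L *v X i \<omega>) \<in> E}"
proof -
  interpret M: prob_space M using M by (simp add: iid_normal_def)
  interpret N: prob_space N using N by (simp add: iid_normal_def)
  let ?P = "PiM {1..n} (\<lambda>_. borel :: (real ^ 'p) measure)"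
  note Lm = borel_measurable_matrix_vector_mult[of L]
  have LX: "(\<lambda>\<omega>. L *v X i \<omega>) \<in> borel_measurable M" if "i \<in> {1..n}" for i
    using measurable_compose[OF iid_normal_distr(1)[OF M that] Lm] .
  have indep: "M.indep_vars (\<lambda>_. borel) (\<lambda>i \<omega>. L *v X i \<omega>) {1..n}"
    using M Lm by (intro M.indep_vars_compose2[where Y="\<lambda>_. (*v) L"]) (auto simp: iid_normal_def)
  have ne: "{1..n} \<noteq> {}" using n by simp
  have marg: "distr N borel (Y i) = distr M borel (\<lambda>\<omega>. L *v X i \<omega>)" if "i \<in> {1..n}" for i
  proof -
    have "distr M borel (\<lambda>\<omega>. L *v X i \<omega>) = distr (distr M borel (X i)) borel ((*v) L)"
      using iid_normal_distr(1)[OF M that] by (subst distr_distr) (simp_all add: comp_def Lm)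
    then show ?thesis
      unfolding iid_normal_distr(2)[OF M that] iid_normal_distr(2)[OF N that]
      using distr_mvnormal_linear[OF L] iid_normal_nn_integral[OF M n] iid_normal_nn_integral[OF N n] by simp
  qed
  have "distr N ?P (\<lambda>\<omega>. \<lambda>i\<in>{1..n}. Y i \<omega>) = PiM {1..n} (\<lambda>i. distr N borel (Y i))"
    using N iid_normal_distr(1)[OF N] by (subst N.indep_vars_iff_distr_eq_PiM'[OF ne, symmetric]) (auto simp: iid_normal_def)
  also have "\<dots> = PiM {1..n} (\<lambda>i. distr M borel (\<lambda>\<omega>. L *v X i \<omega>))"
    using marg by (intro PiM_cong) auto
  also have "\<dots> = distr M ?P (\<lambda>\<omega>. \<lambda>i\<in>{1..n}. L *v X i \<omega>)"
    using M.indep_vars_iff_distr_eq_PiM'[OF ne LX] indep by simp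
  finally show ?thesis
    using measure_sample_event[OF E iid_normal_distr(1)[OF N]] measure_sample_event[OF E LX] by simp
qed

section \<open>Positive probability of open sets of samples\<close>

lemma emeasure_density_open_nonzero:
  fixes f :: "'a :: euclidean_space \<Rightarrow> ennreal"
  assumes f: "f \<in> borel_measurable borel" "\<And>x. 0 < f x" and B: "open B" "B \<noteq> {}"
  shows "emeasure (density lborel f) B \<noteq> 0"
proof
  assume "emeasure (density lborel f) B = 0"
  then have "AE x in lborel. x \<in> B \<longrightarrow> f x = 0"
    using f(1) B(1) null_sets_density_iff[of f lborel B] by (auto simp: null_sets_def)
  then have "AE x in lborel. x \<notin> B" using f(2) by (auto elim!: eventually_mono simp: less_le)
  then have "emeasure lborel B = 0"
    using B(1) by (subst (asm) AE_iff_measurable[of B]) auto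
  then have "negligible B"
    using B(1) by (simp add: negligible_iff_null_sets null_sets_def)
  then show False using open_not_negligible B by blast
qed

text \<open>An open set contains a box around each of its points, and by independence the
  probability that \<open>X 1\<close>, ..., \<open>X n\<close> fall into the sides of the box is a
  finite product of positive numbers.\<close>

lemma measure_iid_normal_open_pos:
  fixes W :: "(nat \<Rightarrow> real ^ 'p :: finite) set"
  assumes M: "iid_normal n M X \<theta> \<Sigma>" and \<Sigma>: "\<Sigma> \<in> pos_def" and n: "1 \<le> n"
    and W: "open W" "W \<noteq> {}" "depends_on_sample n W"
  shows "0 < measure M {\<omega> \<in> space M. (\<lambda>i. X i \<omega>) \<in> W}"
proof -
  interpret prob_space M using M by (simp add: iid_normal_def)
  obtain x0 where x0: "x0 \<in> W" using W(2) by blast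
  have "openin (product_topology (\<lambda>_. euclidean) UNIV) W"
    using W(1) by (simp add: euclidean_product_topology[symmetric] open_openin)
  from product_topology_open_contains_basis[OF this x0]
  obtain B where B: "\<And>i. x0 i \<in> B i" "\<And>i. open (B i)" "(\<Pi>\<^sub>E i\<in>UNIV. B i) \<subseteq> W"
    by (auto simp: PiE_iff)
  let ?f = "\<lambda>x. ennreal (mvnormal_density \<theta> \<Sigma> x)"
  have f: "?f \<in> borel_measurable borel"
    using borel_measurable_mvnormal_density[OF pos_def_invertible[OF \<Sigma>]] by simp
  have "0 < prob (X i -` B i \<inter> space M)" if i: "i \<in> {1..n}" for i
  proof -
    have "B i \<noteq> {}" using B(1)[of i] by blast
    then have "emeasure (distr M borel (X i)) (B i) \<noteq> 0"
      unfolding iid_normal_distr(2)[OF M i] using f B(2) mvnormal_density_pos[OF \<Sigma>]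
      by (intro emeasure_density_open_nonzero) auto
    moreover have "emeasure M (X i -` B i \<inter> space M) = emeasure (distr M borel (X i)) (B i)"
      using iid_normal_distr(1)[OF M i] B(2) by (simp add: emeasure_distr)
    ultimately have "prob (X i -` B i \<inter> space M) \<noteq> 0"
      by (metis emeasure_eq_measure ennreal_0)
    then show ?thesis by (simp add: measure_nonneg less_le)
  qed
  then have "0 < (\<Prod>i\<in>{1..n}. prob (X i -` B i \<inter> space M))" by (rule prod_pos)
  also have "\<dots> = prob (\<Inter>i\<in>{1..n}. X i -` B i \<inter> space M)"
    using M n B(2) by (subst indep_varsD_finite[where M'="\<lambda>_. borel" and A=B]) (auto simp: iid_normal_def)
  also have "\<dots> \<le> prob {\<omega> \<in> space M. (\<lambda>i. X i \<omega>) \<in> W}"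
  proof (rule finite_measure_mono)
    show "{\<omega> \<in> space M. (\<lambda>i. X i \<omega>) \<in> W} \<in> events"
      using W iid_normal_distr(1)[OF M] by (intro sets_sample_event) auto
    show "(\<Inter>i\<in>{1..n}. X i -` B i \<inter> space M) \<subseteq> {\<omega> \<in> space M. (\<lambda>i. X i \<omega>) \<in> W}"
    proof
      fix \<omega> assume \<omega>: "\<omega> \<in> (\<Inter>i\<in>{1..n}. X i -` B i \<inter> space M)"
      \<comment> \<open>Coordinates outside \<open>{1..n}\<close> are borrowed from
        \<open>x0\<close> to land in the whole box; \<open>W\<close> does not notice the
        change.\<close>
      then have "(\<lambda>i. if i \<in> {1..n} then X i \<omega> else x0 i) \<in> (\<Pi>\<^sub>E i\<in>UNIV. B i)"
        using B(1) by auto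
      then have "(\<lambda>i. if i \<in> {1..n} then X i \<omega> else x0 i) \<in> W" using B(3) by blast
      then have "(\<lambda>i. X i \<omega>) \<in> W"
        by (rule depends_on_sampleD[OF W(3)]) simp
      then show "\<omega> \<in> {\<omega> \<in> space M. (\<lambda>i. X i \<omega>) \<in> W}" using \<omega> n by auto
    qed
  qed
  finally show ?thesis .
qed

section \<open>Measurability of the statistic\<close>

lemma
  assumes "\<And>i. i \<in> {1..n} \<Longrightarrow> x i = y i"
  shows sample_mean_cong: "sample_mean n x = sample_mean n y"
    and sample_cov_cong: "sample_cov n x = sample_cov n y"
proof -
  show *: "sample_mean n x = sample_mean n y"
    using assms by (auto simp: sample_mean_def intro!: sum.cong)
  show "sample_cov n x = sample_cov n y"
    using assms by (auto simp: sample_cov_def * intro!: sum.cong)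
qed

lemma depends_on_sample_uit_statistic: "depends_on_sample n {x. P (uit_statistic n C x)}"
proof -
  have "uit_statistic n C x = uit_statistic n C y" if "\<forall>i\<in>{1..n}. x i = y i" for x y
    using that sample_mean_cong[of n x y] sample_cov_cong[of n x y] by (simp add: uit_statistic_def Let_def)
  then show ?thesis unfolding depends_on_sample_def by (metis mem_Collect_eq)
qed

lemma borel_measurable_uit_statistic:
  assumes "2 \<le> n" "closed C" "cone C" "C \<noteq> {}"
  shows "uit_statistic n C \<in> borel_measurable borel"
proof (rule borel_measurableI_greater)
  fix t
  show "{x \<in> space borel. t < uit_statistic n C x} \<in> sets borel"
  proof (cases "0 \<le> t")
    case True
    then show ?thesis using open_uit_statistic_gt[OF assms] by simp
  next
    case False
    then have "{x \<in> space borel. t < uit_statistic n C x} = UNIV"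
      by (auto simp: not_le intro: less_le_trans[OF _ uit_statistic_nonneg])
    then show ?thesis by simp
  qed
qed

section \<open>Half-spaces and steep cones\<close>

lemma closed_cone_upper_halfspace:
  defines "H \<equiv> upper_halfspace :: (real ^ 'p :: {finite, linorder}) set"
  shows "closed H" "cone H" "H \<noteq> {}"
proof -
  show "closed H"
    unfolding H_def upper_halfspace_def by (intro closed_Collect_le continuous_intros)
  show "cone H"
    by (auto simp: H_def cone_def upper_halfspace_def)
  have "0 \<in> H" by (simp add: H_def upper_halfspace_def)
  then show "H \<noteq> {}" by blast
qed

text \<open>The sample consists of all unit vectors, at distinct indices, and zeros elsewhere; a
  zero occurs at \<open>i0\<close> because \<open>n\<close> exceeds the dimension. If the form
  vanishes at \<open>v\<close>, this zero shows that the mean is orthogonal to \<open>v\<close>, and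
  then so is every unit vector.\<close>

lemma exists_sample_cov_pos_def:
  assumes "CARD('p :: finite) < n"
  shows "\<exists>x. sample_cov n x \<in> (pos_def :: (real ^ 'p ^ 'p) set)"
proof -
  have "\<exists>f :: 'p \<Rightarrow> nat. f ` UNIV \<subseteq> {1..n} \<and> inj_on f UNIV"
    using assms by (intro card_le_inj) auto
  then obtain f :: "'p \<Rightarrow> nat" where f: "range f \<subseteq> {1..n}" "inj f" by blast
  have "card (range f) < card {1..n}" using assms f(2) by (simp add: card_image)
  then have "range f \<noteq> {1..n}" by auto
  then obtain i0 where i0: "i0 \<in> {1..n}" "i0 \<notin> range f" using f(1) by blast
  define x :: "nat \<Rightarrow> real ^ 'p" where "x = (\<lambda>i. if i \<in> range f then axis (inv f i) 1 else 0)"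
  let ?m = "sample_mean n x"
  have "0 < v \<bullet> (sample_cov n x *v v)" if "v \<noteq> 0" for v
  proof (rule ccontr)
    assume "\<not> ?thesis"
    moreover have "0 < CARD('p)" by simp
    then have "0 < real n - 1" using assms by linarith
    ultimately have "(\<Sum>i=1..n. ((x i - ?m) \<bullet> v)\<^sup>2) \<le> 0"
      by (simp add: inner_sample_cov field_simps not_less)
    then have "(\<Sum>i=1..n. ((x i - ?m) \<bullet> v)\<^sup>2) = 0"
      by (intro antisym sum_nonneg) auto
    then have 0: "\<forall>i\<in>{1..n}. (x i - ?m) \<bullet> v = 0"
      by (subst (asm) sum_nonneg_eq_0_iff) auto
    have "?m \<bullet> v = 0" using bspec[OF 0 i0(1)] i0(2) by (simp add: x_def)
    moreover have "(x (f j) - ?m) \<bullet> v = 0" for j using 0 f(1) by blast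
    ultimately have "axis j 1 \<bullet> v = 0" for j
      using f(2) by (simp add: x_def inner_diff_left)
    then have "v = 0" by (simp add: vec_eq_iff inner_axis')
    then show False using that by simp
  qed
  then show ?thesis by (auto simp: pos_def_def transpose_sample_cov)
qed

lemma
  assumes "1 \<le> n"
  shows sample_mean_translate: "sample_mean n (\<lambda>i. x i + m) = sample_mean n x + m"
    and sample_cov_translate: "sample_cov n (\<lambda>i. x i + m) = sample_cov n x"
proof -
  show *: "sample_mean n (\<lambda>i. x i + m) = sample_mean n x + m"
    using assms by (simp add: sample_mean_def sum.distrib scaleR_add_right sum_constant_scaleR del: sum_constant)
  show "sample_cov n (\<lambda>i. x i + m) = sample_cov n x"
    by (simp add: sample_cov_def *)
qed

lemma gain_le:
  assumes "A \<in> pos_def"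
  shows "gain A z y \<le> gain A z z"
proof -
  obtain K :: "real ^ 'a ^ 'a" where "inner_wrt A x y = (K *v x) \<bullet> (K *v y)" for x y
    using pos_def_inner_wrt_eq_inner[OF assms] by blast
  moreover have "0 \<le> (norm (K *v z - K *v y))\<^sup>2" by simp
  ultimately show ?thesis
    unfolding power2_norm_eq_inner by (simp add: gain_def inner_diff_left inner_diff_right inner_commute)
qed

lemma inner_wrt_pos:
  assumes "A \<in> pos_def" "x \<noteq> 0"
  shows "0 < inner_wrt A x x"
proof -
  obtain K :: "real ^ 'a ^ 'a" where K: "invertible K" "inner_wrt A x y = (K *v x) \<bullet> (K *v y)" for x y
    using pos_def_inner_wrt_eq_inner[OF assms(1)] by blast
  have "K *v x \<noteq> 0"
    using K(1) assms(2) by (metis invertible_left_inverse matrix_left_invertible_ker)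
  then show ?thesis by (simp add: K(2))
qed

text \<open>Where the scaled mean lies in the half-space it is its own projection, so the statistic
  is its squared norm, which is continuous on nonsingular samples. The strict condition on the last
  coordinate keeps \<open>W\<close> open.\<close>

lemma exists_open_statistic_between:
  fixes a b :: real
  assumes n: "CARD('p :: {finite, linorder}) < n" and ab: "0 \<le> a" "a < b"
  shows "\<exists>W :: (nat \<Rightarrow> real ^ ('p :: _)) set. open W \<and> W \<noteq> {} \<and> depends_on_sample n W \<and>
    (\<forall>x\<in>W. a < uit_statistic n upper_halfspace x \<and> uit_statistic n upper_halfspace x < b)"
proof -
  have "0 < CARD('p)" by simp
  then have n2: "2 \<le> n" and n1: "1 \<le> n" using n by linarith+
  let ?z = "\<lambda>x. sqrt (real n) *\<^sub>R sample_mean n x"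
  let ?k = "Max UNIV :: 'p"
  define W :: "(nat \<Rightarrow> real ^ ('p :: _)) set" where
    "W = {x. det (sample_cov n x) \<noteq> 0 \<and> gain (sample_cov n x) (?z x) (?z x) \<in> {a<..<b}} \<inter>
      {x. 0 < ?z x $ ?k}"
  have "open W"
    unfolding W_def
    by (intro open_Int open_sample_gain open_Collect_less continuous_intros continuous_on_sample_mean open_greaterThanLessThan)
  moreover have "depends_on_sample n W"
    using sample_mean_cong[of n] sample_cov_cong[of n] unfolding depends_on_sample_def W_def
    by (metis (mono_tags, lifting) Int_iff mem_Collect_eq)
  moreover have "W \<noteq> {}"
  proof -
    obtain x0 :: "nat \<Rightarrow> real ^ ('p :: _)" where x0: "sample_cov n x0 \<in> pos_def"
      using exists_sample_cov_pos_def[OF n] by blast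
    let ?S = "sample_cov n x0"
    define q where "q = inner_wrt ?S (axis ?k 1) (axis ?k 1)"
    have q: "q > 0" unfolding q_def by (intro inner_wrt_pos x0) (simp add: axis_eq_0_iff)
    \<comment> \<open>Chosen so that \<open>r *\<^sub>R axis ?k 1\<close> has squared norm
      \<open>(a + b) / 2\<close> with respect to \<open>?S\<close>.\<close>
    define r where "r = sqrt ((a + b) / 2 / q)"
    have r: "r > 0" "r\<^sup>2 * q = (a + b) / 2" using q ab by (auto simp: r_def)
    \<comment> \<open>Translation by \<open>m\<close> moves the scaled mean to this vector and
      leaves the covariance unchanged.\<close>
    define m where "m = (r / sqrt (real n)) *\<^sub>R axis ?k 1 - sample_mean n x0"
    define x where "x = (\<lambda>i. x0 i + m)"
    have S: "sample_cov n x = ?S" and z: "?z x = r *\<^sub>R axis ?k 1"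
      using n1 by (simp_all add: x_def sample_mean_translate sample_cov_translate m_def)
    have "gain ?S (?z x) (?z x) = r\<^sup>2 * q"
      unfolding z by (simp add: gain_def q_def inner_wrt_def matrix_vector_mult_scaleR power2_eq_square)
    moreover have "0 < ?z x $ ?k" unfolding z using r(1) by (simp add: axis_def)
    moreover have "det ?S \<noteq> 0" using x0 sample_cov_pos_def_iff[OF n2] by blast
    ultimately have "x \<in> W"
      unfolding W_def Int_iff mem_Collect_eq S using r(2) ab by simp
    then show ?thesis by blast
  qed
  moreover have "a < uit_statistic n upper_halfspace x \<and> uit_statistic n upper_halfspace x < b" if x: "x \<in> W" for x
  proof -
    let ?g = "gain (sample_cov n x) (?z x)"
    have pd: "sample_cov n x \<in> pos_def" and g: "a < ?g (?z x)" "?g (?z x) < b" and zH: "?z x \<in> upper_halfspace"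
      using x by (auto simp: W_def sample_cov_pos_def_iff[OF n2] upper_halfspace_def)
    have "a < uit_statistic n upper_halfspace x"
      unfolding uit_statistic_gt_iff[OF closed_cone_upper_halfspace ab(1)] using pd g(1) zH by blast
    moreover have "\<not> ?g (?z x) < uit_statistic n upper_halfspace x"
    proof -
      have "0 \<le> ?g (?z x)" using g(1) ab by simp
      then show ?thesis
        unfolding uit_statistic_gt_iff[OF closed_cone_upper_halfspace \<open>0 \<le> ?g (?z x)\<close>]
        using gain_le[OF pd] by (auto simp: not_less)
    qed
    ultimately show ?thesis using g(2) by linarith
  qed
  ultimately show ?thesis by blast
qed

text \<open>Closed circular cones around the last axis, increasing in \<open>k\<close>; their union
  is the interior of the upper half-space together with the origin.\<close>

definition steep_cone :: "nat \<Rightarrow> (real ^ 'p :: {finite, linorder}) set" where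
  "steep_cone k = {y. norm y \<le> real k * y $ Max UNIV}"

lemma closed_cone_steep_cone: "closed (steep_cone k)" "cone (steep_cone k)" "steep_cone k \<noteq> {}"
proof -
  show "closed (steep_cone k)"
    unfolding steep_cone_def by (intro closed_Collect_le continuous_intros)
  show "cone (steep_cone k)"
    by (auto simp: cone_def steep_cone_def mult.left_commute mult_left_mono)
  have "0 \<in> steep_cone k" by (simp add: steep_cone_def)
  then show "steep_cone k \<noteq> {}" by blast
qed

lemma steep_cone_mono:
  assumes "j \<le> k"
  shows "steep_cone j \<subseteq> steep_cone k"
proof
  fix y :: "real ^ ('a :: _)" assume y: "y \<in> steep_cone j"
  then have "0 \<le> real j * y $ Max UNIV" unfolding steep_cone_def using norm_ge_zero order_trans by blast
  then have "real j * y $ Max UNIV \<le> real k * y $ Max UNIV"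
  proof (cases "j = 0")
    case True
    then have "y = 0" using y by (simp add: steep_cone_def)
    then show ?thesis by simp
  next
    case False
    then have "0 \<le> y $ Max UNIV" using \<open>0 \<le> real j * y $ Max UNIV\<close> by (simp add: zero_le_mult_iff)
    then show ?thesis using assms by (intro mult_right_mono) auto
  qed
  then show "y \<in> steep_cone k" using y by (simp add: steep_cone_def)
qed

text \<open>The gain is continuous in \<open>y\<close>, so a witness on the boundary of the
  half-space can be pushed slightly inwards, where some steep cone contains it.\<close>

lemma uit_statistic_halfspace_gt_iff:
  fixes x :: "nat \<Rightarrow> real ^ 'p :: {finite, linorder}"
  assumes n: "2 \<le> n" and t: "0 \<le> t"
  shows "t < uit_statistic n upper_halfspace x \<longleftrightarrow> (\<exists>k. t < uit_statistic n (steep_cone k) x)"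
proof
  let ?S = "sample_cov n x" and ?z = "sqrt (real n) *\<^sub>R sample_mean n x"
  assume "t < uit_statistic n upper_halfspace x"
  then obtain y where pd: "?S \<in> pos_def" and y: "y \<in> upper_halfspace" "t < gain ?S ?z y"
    unfolding uit_statistic_gt_iff[OF closed_cone_upper_halfspace t] by blast
  let ?e = "axis (Max UNIV) 1 :: real ^ ('p :: _)"
  have "continuous_on UNIV (\<lambda>s. gain ?S ?z (y + s *\<^sub>R ?e))"
    unfolding gain_def using pos_def_invertible[OF pd] unfolding invertible_det_nz
    by (intro continuous_intros continuous_on_inner_wrt)
  then have "open {s. t < gain ?S ?z (y + s *\<^sub>R ?e)}"
    by (intro open_Collect_less continuous_intros)
  moreover have "0 \<in> {s. t < gain ?S ?z (y + s *\<^sub>R ?e)}" using y(2) by simp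
  ultimately obtain d where d: "d > 0" "ball 0 d \<subseteq> {s. t < gain ?S ?z (y + s *\<^sub>R ?e)}"
    by (rule openE)
  \<comment> \<open>A shift by \<open>d / 2\<close> stays inside the ball and makes the last
    coordinate positive.\<close>
  define y' where "y' = y + (d / 2) *\<^sub>R ?e"
  have "d / 2 \<in> ball 0 d" using d(1) by simp
  then have "d / 2 \<in> {s. t < gain ?S ?z (y + s *\<^sub>R ?e)}" using d(2) by blast
  then have y': "t < gain ?S ?z y'" by (simp add: y'_def)
  have pos: "0 < y' $ Max UNIV" using y(1) d(1) by (simp add: y'_def upper_halfspace_def axis_def)
  obtain k where "norm y' / y' $ Max UNIV \<le> real k" using real_arch_simple by blast
  then have "y' \<in> steep_cone k" using pos by (simp add: steep_cone_def field_simps)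
  then show "\<exists>k. t < uit_statistic n (steep_cone k) x"
    using y' pd unfolding uit_statistic_gt_iff[OF closed_cone_steep_cone t] by blast
next
  assume "\<exists>k. t < uit_statistic n (steep_cone k) x"
  then obtain k where k: "t < uit_statistic n (steep_cone k) x" by blast
  have "steep_cone k \<subseteq> (upper_halfspace :: (real ^ ('p :: _)) set)"
  proof
    fix y :: "real ^ ('p :: _)" assume "y \<in> steep_cone k"
    then have *: "norm y \<le> real k * y $ Max UNIV" by (simp add: steep_cone_def)
    show "y \<in> upper_halfspace"
    proof (rule ccontr)
      assume "y \<notin> upper_halfspace"
      then have "y $ Max UNIV < 0" by (simp add: upper_halfspace_def)
      then have "norm y \<le> 0" using * by (meson mult_nonneg_nonpos of_nat_0_le_iff less_imp_le order_trans)
      then show False using \<open>y $ Max UNIV < 0\<close> by simp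
    qed
  qed
  then show "t < uit_statistic n upper_halfspace x"
    using uit_statistic_mono[OF closed_cone_steep_cone closed_cone_upper_halfspace(1,2)] k less_le_trans by blast
qed

text \<open>The map sends the last unit vector to an interior point \<open>u\<close> of
  \<open>C\<close> and shrinks its orthogonal complement by \<open>\<epsilon>\<close>, which
  squeezes the steep cone into the cone over a small ball around \<open>u\<close>.\<close>

lemma steep_cone_linear_into:
  fixes C U :: "(real ^ 'p :: {finite, linorder}) set"
  assumes C: "cone C" and U: "open U" "U \<noteq> {}" "U \<subseteq> C" and CH: "C \<subseteq> upper_halfspace"
  shows "\<exists>L :: real ^ ('p :: _) ^ ('p :: _). invertible L \<and> steep_cone k \<subseteq> (*v) L -` C"
proof -
  let ?p = "Max UNIV :: 'p"
  let ?e = "axis ?p 1 :: real ^ ('p :: _)"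
  obtain u r where r: "r > 0" and ball: "ball u r \<subseteq> C"
    using U by (meson open_contains_ball all_not_in_conv order_trans)
  \<comment> \<open>Even after a step down the last axis the point is in the half-space, so the last
    coordinate of \<open>u\<close> is positive; this makes \<open>f\<close> injective.\<close>
  have "u - (r / 2) *\<^sub>R ?e \<in> ball u r" using r by (simp add: dist_norm)
  then have "u - (r / 2) *\<^sub>R ?e \<in> upper_halfspace" using ball CH by blast
  then have up: "0 < u $ ?p" using r by (simp add: upper_halfspace_def axis_def)
  \<comment> \<open>A point of the steep cone with last coordinate 1 is at distance at most
    \<open>k + 1\<close> from \<open>?e\<close>, so its image is within \<open>r / 2\<close> of
    \<open>u\<close>.\<close>
  define \<epsilon> where "\<epsilon> = r / (2 * (real k + 1))"
  have \<epsilon>: "\<epsilon> > 0" using r by (simp add: \<epsilon>_def)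
  define f :: "real ^ ('p :: _) \<Rightarrow> real ^ ('p :: _)" where "f = (\<lambda>y. y $ ?p *\<^sub>R u + \<epsilon> *\<^sub>R (y - y $ ?p *\<^sub>R ?e))"
  have lin: "linear f"
    by (intro linearI) (auto simp: f_def algebra_simps)
  have fp: "f y $ ?p = y $ ?p * u $ ?p" for y by (simp add: f_def axis_def)
  define L where "L = matrix f"
  have L: "L *v y = f y" for y by (simp add: L_def lin)
  have "y = 0" if "f y = 0" for y
  proof -
    have "y $ ?p = 0" using fp[of y] that up by simp
    then show ?thesis using that \<epsilon> by (simp add: f_def)
  qed
  then have "invertible L"
    unfolding invertible_left_inverse matrix_left_invertible_ker by (simp add: L)
  moreover have "L *v y \<in> C" if y: "y \<in> steep_cone k" for y
  proof (cases "y $ ?p = 0")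
    case True
    then have "y = 0" using y by (simp add: steep_cone_def)
    have "0 \<in> C" using C U by (metis cone_contains_0 subset_empty)
    then show ?thesis by (simp add: \<open>y = 0\<close>)
  next
    case False
    let ?t = "y $ ?p"
    have ny: "norm y \<le> real k * ?t" using y by (simp add: steep_cone_def)
    then have "0 \<le> real k * ?t" using norm_ge_zero order_trans by blast
    moreover have "k \<noteq> 0" using ny False by (intro notI) simp
    ultimately have t: "?t > 0" using False by (simp add: zero_le_mult_iff)
    let ?v = "inverse ?t *\<^sub>R y - ?e"
    have "norm (inverse ?t *\<^sub>R y) \<le> real k" using ny t by (simp add: field_simps)
    then have "norm ?v \<le> real k + 1"
      using norm_triangle_ineq4[of "inverse ?t *\<^sub>R y" ?e] by simp
    then have "norm (\<epsilon> *\<^sub>R ?v) \<le> \<epsilon> * (real k + 1)"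
      unfolding norm_scaleR using \<epsilon> by (simp add: mult_left_mono)
    also have "\<dots> = r / 2" by (simp add: \<epsilon>_def field_simps)
    finally have "norm (\<epsilon> *\<^sub>R ?v) \<le> r / 2" .
    then have "u + \<epsilon> *\<^sub>R ?v \<in> ball u r" using r by (simp add: dist_norm)
    then have "?t *\<^sub>R (u + \<epsilon> *\<^sub>R ?v) \<in> C" using C ball t by (auto simp: cone_def)
    also have "?t *\<^sub>R (u + \<epsilon> *\<^sub>R ?v) = L *v y" using t by (simp add: L f_def algebra_simps)
    finally show ?thesis .
  qed
  ultimately show ?thesis by (intro exI[of _ L]) auto
qed

text \<open>At mean 0, changing the covariance is the same as transforming the sample linearly,
  hence as changing the cone. The supremum over covariances thus covers all linear preimages of
  \<open>C\<close> at the identity covariance.\<close>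

lemma power_fn_null_linear:
  fixes C :: "(real ^ 'p :: finite) set" and L :: "real ^ 'p ^ 'p"
  assumes iid: "\<And>\<theta> \<Sigma>. \<Sigma> \<in> pos_def \<Longrightarrow> iid_normal n (M \<theta> \<Sigma>) X \<theta> \<Sigma>"
    and n: "2 \<le> n" and C: "closed C" "cone C" "C \<noteq> {}" and L: "invertible L"
  shows "power_fn M X (uit n C c) 0 (L ** transpose L) = power_fn M X (uit n ((*v) L -` C) c) 0 (mat 1)"
proof -
  let ?E = "{x. c \<le> uit_statistic n C x}"
  have "L ** transpose L \<in> pos_def"
    using pos_def_congruence[OF L pos_def_mat_1] by simp
  moreover have "?E \<in> sets borel"
    using borel_measurable_uit_statistic[OF n C] by measurable
  ultimately show ?thesis
    using measure_iid_normal_linear[OF iid iid _ L _ depends_on_sample_uit_statistic, of "\<lambda>t. c \<le> t" C] n pos_def_mat_1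
    by (simp add: power_fn_def uit_def uit_statistic_linear[OF n C L])
qed

theorem proposition3p1:
  fixes M :: "real ^ ('p :: {finite, linorder}) \<Rightarrow> real ^ ('p :: _) ^ ('p :: _) \<Rightarrow> 'a measure"
    and X :: "nat \<Rightarrow> 'a \<Rightarrow> real ^ ('p :: _)"
    and C U :: "(real ^ ('p :: _)) set"
    and n :: nat
    and \<alpha> c c' :: real
  assumes "CARD('p) < n"
    and "\<And>\<theta> \<Sigma>. \<Sigma> \<in> pos_def \<Longrightarrow> iid_normal n (M \<theta> \<Sigma>) X \<theta> \<Sigma>"
    and "closed C" and "convex C" and "cone C"
    and "open U" and "U \<noteq> {}"
    and "U \<subseteq> C" and "C \<subseteq> upper_halfspace"
    and "0 < \<alpha>" and "\<alpha> < 1"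
    and "critical_value M X n C \<alpha> c"
    and "critical_value M X n upper_halfspace \<alpha> c'"
  shows "dominated_by M X C (uit n C c) (uit n upper_halfspace c')"
proof -
  let ?H = "upper_halfspace :: (real ^ ('p :: _)) set"
  let ?T = "uit_statistic n"
  note iid = assms(2)
  have "0 < CARD('p)" by simp
  then have n2: "2 \<le> n" and n1: "1 \<le> n" using assms(1) by linarith+
  have C: "closed C" "cone C" "C \<noteq> {}" using assms(3,5,7,8) by auto
  note H = closed_cone_upper_halfspace
  have prob: "prob_space (M \<theta> \<Sigma>)" if "\<Sigma> \<in> pos_def" for \<theta> \<Sigma>
    using iid[OF that] by (simp add: iid_normal_def)
  have events: "{\<omega> \<in> space (M \<theta> \<Sigma>). P (?T D (\<lambda>i. X i \<omega>))} \<in> sets (M \<theta> \<Sigma>)"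
    if "\<Sigma> \<in> pos_def" "closed D" "cone D" "D \<noteq> {}" "{t. P t} \<in> sets borel" for \<theta> \<Sigma> D P
  proof -
    have "{x. P (?T D x)} \<in> sets borel"
      using measurable_sets[OF borel_measurable_uit_statistic[OF n2 that(2-4)] that(5)] by (simp add: vimage_def)
    from sets_sample_event[OF this depends_on_sample_uit_statistic iid_normal_distr(1)[OF iid[OF that(1)]]]
    show ?thesis by simp
  qed
  \<comment> \<open>Boundedness is needed to place each rejection probability below the real
    supremum.\<close>
  have bdd: "bdd_above ((\<lambda>\<Sigma>. power_fn M X \<phi> 0 \<Sigma>) ` pos_def)" for \<phi>
    using prob by (intro bdd_aboveI[of _ 1]) (auto simp: power_fn_def prob_space.prob_le_1)

  have "c' \<le> c"
  proof (rule ccontr)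
    assume "\<not> c' \<le> c"
    have c: "0 < c" using assms(12) by (simp add: critical_value_def)
    interpret N: prob_space "M 0 (mat 1)" using prob[OF pos_def_mat_1] .
    note events1 = events[OF pos_def_mat_1]
    \<comment> \<open>The factor \<open>L\<close> of \<open>\<Sigma>\<close> is taken to preserve
      the half-space, so the null law of its statistic is the same for all
      \<open>\<Sigma>\<close>.\<close>
    have const_H: "power_fn M X (uit n ?H c') 0 \<Sigma> = power_fn M X (uit n ?H c') 0 (mat 1)"
      if \<Sigma>: "\<Sigma> \<in> pos_def" for \<Sigma>
    proof -
      obtain L :: "real ^ ('p :: _) ^ ('p :: _)" and a where L: "invertible L" "\<Sigma> = L ** transpose L" "0 < a"
        "\<And>x. (L *v x) $ Max UNIV = a * x $ Max UNIV"
        using pos_def_factor[OF \<Sigma>] by blast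
      have "(*v) L -` ?H = ?H" using L(3,4) by (auto simp: upper_halfspace_def zero_le_mult_iff)
      then show ?thesis using power_fn_null_linear[OF iid n2 H L(1), of c'] L(2) by simp
    qed
    have "(SUP \<Sigma>\<in>pos_def. power_fn M X (uit n ?H c') 0 \<Sigma>) = power_fn M X (uit n ?H c') 0 (mat 1)"
      using pos_def_mat_1 by (subst SUP_cong[OF refl const_H]) (auto intro!: cSUP_const)
    then have \<alpha>: "N.prob {\<omega> \<in> space (M 0 (mat 1)). c' \<le> ?T ?H (\<lambda>i. X i \<omega>)} = \<alpha>"
      using assms(13) by (simp add: critical_value_def power_fn_def uit_def)
    \<comment> \<open>These events increase to the event that the half-space statistic exceeds
      \<open>c\<close>, and each has probability at most the size \<open>\<alpha>\<close> of the
      test for \<open>C\<close>.\<close>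
    define A where "A = (\<lambda>k. {\<omega> \<in> space (M 0 (mat 1)). c < ?T (steep_cone k) (\<lambda>i. X i \<omega>)})"
    have A: "A k \<in> N.events" for k
      unfolding A_def by (intro events1 closed_cone_steep_cone) simp
    have "N.prob (A k) \<le> \<alpha>" for k
    proof -
      obtain L :: "real ^ ('p :: _) ^ ('p :: _)" where L: "invertible L" "steep_cone k \<subseteq> (*v) L -` C"
        using steep_cone_linear_into[OF C(2) assms(6-9)] by blast
      note LC = closed_cone_linear_vimage[OF C, of L]
      have "N.prob (A k) \<le> power_fn M X (uit n ((*v) L -` C) c) 0 (mat 1)"
        unfolding power_fn_def uit_def A_def
        using uit_statistic_mono[OF closed_cone_steep_cone LC(1,2) L(2)]
        by (intro N.finite_measure_mono events1 LC) (auto intro: order_trans[OF less_imp_le])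
      also have "\<dots> = power_fn M X (uit n C c) 0 (L ** transpose L)"
        using power_fn_null_linear[OF iid n2 C L(1)] by simp
      also have "\<dots> \<le> (SUP \<Sigma>\<in>pos_def. power_fn M X (uit n C c) 0 \<Sigma>)"
        using pos_def_congruence[OF L(1) pos_def_mat_1] by (intro cSUP_upper bdd) simp
      also have "\<dots> = \<alpha>" using assms(12) by (simp add: critical_value_def)
      finally show ?thesis .
    qed
    moreover have "incseq A"
    proof -
      have "?T (steep_cone i) x \<le> ?T (steep_cone j) x" if "i \<le> j" for i j and x :: "nat \<Rightarrow> real ^ ('p :: _)"
        using uit_statistic_mono[OF closed_cone_steep_cone closed_cone_steep_cone(1,2) steep_cone_mono[OF that]] .
      then show ?thesis
        unfolding incseq_def A_def by (auto intro: less_le_trans)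
    qed
    then have "(\<lambda>k. N.prob (A k)) \<longlonglongrightarrow> N.prob (\<Union>k. A k)"
      using A by (intro N.finite_Lim_measure_incseq) auto
    ultimately have "N.prob (\<Union>k. A k) \<le> \<alpha>"
      by (intro LIMSEQ_le_const2) auto
    moreover have "(\<Union>k. A k) = {\<omega> \<in> space (M 0 (mat 1)). c < ?T ?H (\<lambda>i. X i \<omega>)}"
      using c by (auto simp: A_def uit_statistic_halfspace_gt_iff[OF n2])
    ultimately have le: "N.prob {\<omega> \<in> space (M 0 (mat 1)). c < ?T ?H (\<lambda>i. X i \<omega>)} \<le> \<alpha>" by simp

    \<comment> \<open>On \<open>W\<close> the half-space statistic exceeds \<open>c\<close> but does
      not reach \<open>c'\<close>. The event of \<open>W\<close> is therefore disjoint from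
      \<open>?R\<close>, and its positive probability pushes the probability of exceeding
      \<open>c\<close> above \<open>\<alpha>\<close>.\<close>
    obtain W :: "(nat \<Rightarrow> real ^ ('p :: _)) set" where W: "open W" "W \<noteq> {}" "depends_on_sample n W"
      "\<And>x. x \<in> W \<Longrightarrow> c < ?T ?H x \<and> ?T ?H x < c'"
      using exists_open_statistic_between[OF assms(1), of c c'] c \<open>\<not> c' \<le> c\<close> by auto
    let ?W = "{\<omega> \<in> space (M 0 (mat 1)). (\<lambda>i. X i \<omega>) \<in> W}"
    let ?R = "{\<omega> \<in> space (M 0 (mat 1)). c' \<le> ?T ?H (\<lambda>i. X i \<omega>)}"
    have meas: "?W \<in> N.events" "?R \<in> N.events"
      using W(1,3) iid_normal_distr(1)[OF iid[OF pos_def_mat_1]]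
      by (auto intro!: sets_sample_event events1 H)
    have "0 < N.prob ?W"
      by (rule measure_iid_normal_open_pos[OF iid[OF pos_def_mat_1] pos_def_mat_1 n1 W(1-3)])
    moreover have "N.prob ?W + N.prob ?R = N.prob (?W \<union> ?R)"
      using meas W(4) by (intro N.finite_measure_Union[symmetric]) (auto simp: not_le[symmetric])
    moreover have "N.prob (?W \<union> ?R) \<le> N.prob {\<omega> \<in> space (M 0 (mat 1)). c < ?T ?H (\<lambda>i. X i \<omega>)}"
      using W(4) \<open>\<not> c' \<le> c\<close> by (intro N.finite_measure_mono events1 H) auto
    ultimately show False using \<alpha> le by simp
  qed

  show ?thesis
    unfolding dominated_by_def
  proof (intro ballI)
    fix \<theta> and \<Sigma> :: "real ^ ('p :: _) ^ ('p :: _)" assume \<Sigma>: "\<Sigma> \<in> pos_def"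
    interpret prob_space "M \<theta> \<Sigma>" using prob[OF \<Sigma>] .
    have "?T C x \<le> ?T ?H x" for x
      using uit_statistic_mono[OF C H(1,2) assms(9)] .
    then show "power_fn M X (uit n C c) \<theta> \<Sigma> \<le> power_fn M X (uit n ?H c') \<theta> \<Sigma>"
      unfolding power_fn_def uit_def using \<open>c' \<le> c\<close>
      by (intro finite_measure_mono events \<Sigma> H) (auto intro: order_trans)
  qed
qed

end
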